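(* Let $k\ge 1$ be an integer and let $(P_{k,n})_{n\ge0}$ be the generalized $k$-Pell-Tribonacci sequence. For every integer $n\geq 0$, $$\sum_{i=0}^{n}P_{k,i}=\frac{P_{k,n+3}+(1-2k)P_{k,n+2}+(1-3k)P_{k,n+1}-1}{3k}.$$
   Context: For an integer $k\geq 1$, the generalized $k$-Pell-Tribonacci sequence $(P_{k,n})_{n\ge 0}$ is defined by $P_{k,0}=0$, $P_{k,1}=1$, $P_{k,2}=2k$ and $P_{k,n}=2kP_{k,n-1}+kP_{k,n-2}+P_{k,n-3}$ for $n\geq 3$. *)

theory Defs
  imports Complex_Main
begin

fun pell_trib :: "int \<Rightarrow> nat \<Rightarrow> int" where
  "pell_trib k 0 = 0"
| "pell_trib k (Suc 0) = 1"
| "pell_trib k (Suc (Suc 0)) = 2 * k"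
| "pell_trib k (Suc (Suc (Suc n))) =
     2 * k * pell_trib k (Suc (Suc n)) + k * pell_trib k (Suc n) + pell_trib k n"

end

theory Submission
  imports Defs
begin

text \<open>The sum telescopes. Passing from \<open>n\<close> to \<open>n + 1\<close>, the
  right-hand side of \<open>pell_trib_sum\<close> grows by P(n+4) - 2k P(n+3) - k P(n+2) - (1-3k)
  P(n+1), which the recurrence reduces to 3k P(n+1); at \<open>n = 0\<close> both sides vanish.
  Keeping the factor 3k on the left leaves an integer identity; division is done in the
  reals.\<close>

lemma pell_trib_sum:
  "3 * k * (\<Sum>i=0..n. pell_trib k i) =
    pell_trib k (n + 3) + (1 - 2 * k) * pell_trib k (n + 2) + (1 - 3 * k) * pell_trib k (n + 1) - 1"
  \<comment> \<open>\<open>numeral_eq_Suc\<close> exposes the successors on which the recurrence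
    matches.\<close>
  by (induction n) (simp_all add: numeral_eq_Suc algebra_simps)

theorem proposition2:
  fixes k :: int and n :: nat
  assumes "k \<ge> 1"
  shows "(\<Sum>i=0..n. real_of_int (pell_trib k i)) =
    (real_of_int (pell_trib k (n + 3)) + (1 - 2 * real_of_int k) * real_of_int (pell_trib k (n + 2))
      + (1 - 3 * real_of_int k) * real_of_int (pell_trib k (n + 1)) - 1) / (3 * real_of_int k)"
proof -
  have "3 * real_of_int k * (\<Sum>i=0..n. real_of_int (pell_trib k i)) =
    real_of_int (pell_trib k (n + 3)) + (1 - 2 * real_of_int k) * real_of_int (pell_trib k (n + 2))
      + (1 - 3 * real_of_int k) * real_of_int (pell_trib k (n + 1)) - 1"
    \<comment> \<open>Only the cast is pushed inward here; the recurrence stays folded.\<close>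
    using arg_cong[OF pell_trib_sum[of k n], of real_of_int]
    by (simp del: pell_trib.simps)
  moreover have "3 * real_of_int k \<noteq> 0"
    using assms by simp
  ultimately show ?thesis
    by (metis nonzero_mult_div_cancel_left)
qed

end
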